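(* Let $n \geq d \geq 4000$ be integers and let $\kappa \geq 1$ be real. Let $\Phi : \{1,\dots,d\}^n \to \mathcal{P}_d$ be an estimator such that, denoting $\widehat P_n = \Phi(X_1,\dots,X_n)$, for every $P \in \mathcal{P}_d$ one has $$\mathbb{P}_P\Big( \mathrm{KL}(P,\widehat P_n) \leq \frac{\kappa d}{n} \Big) > 0 .$$ Then, for any $\delta \in (e^{-n}, e^{-16\kappa^2})$, there exists a distribution $P \in \mathcal{P}_d$ such that $$\mathbb{P}_P\bigg( \mathrm{KL}(P,\widehat P_n) \geq \frac{d + \log(1/\delta)\log\log(1/\delta)}{5000\, n} \bigg) \geq \delta .$$
   Context: $\mathcal{P}_d$ is the set of probability vectors $P=(p_1,\dots,p_d)$ (with $p_j\ge 0$, $\sum_j p_j=1$), identified with probability distributions on $\{1,\dots,d\}$. $X_1,\dots,X_n$ are i.i.d. with distribution $P$ and $\mathbb{P}_P$ is probability under this law. For $P,Q\in\mathcal{P}_d$, $\mathrm{KL}(P,Q)=\sum_{j=1}^d p_j\log(p_j/q_j)\in[0,+\infty]$, with the convention that a term is $0$ if $p_j=0$ and $+\infty$ if $p_j>0=q_j$. $\log$ is the natural logarithm. *)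

theory Defs
  imports "HOL-Probability.Probability"
begin

definition prob_vectors :: "nat \<Rightarrow> nat pmf set" where
  "prob_vectors d = {P. set_pmf P \<subseteq> {1..d}}"

(* The joint law of X_1, ..., X_n i.i.d. with distribution P. Since the default value is
   undefined, it lives on the extensional functions {1..n} \<rightarrow>\<^sub>E S, S the support of P. *)
definition sample_pmf :: "nat \<Rightarrow> nat pmf \<Rightarrow> (nat \<Rightarrow> nat) pmf" where
  "sample_pmf n P = Pi_pmf {1..n} undefined (\<lambda>_. P)"

(* The library's KL_divergence is real-valued, so it cannot express the value \<infinity>
   when P is not absolutely continuous with respect to Q. *)
definition KL :: "nat \<Rightarrow> nat pmf \<Rightarrow> nat pmf \<Rightarrow> ereal" where
  "KL d P Q = (\<Sum>j = 1..d.
     if pmf P j = 0 then 0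
     else if pmf Q j = 0 then \<infinity>
     else ereal (pmf P j * ln (pmf P j / pmf Q j)))"

end

theory Submission
  imports Defs
begin

text \<open>Let \<open>L = ln (1 / \<delta>)\<close>. If \<open>d \<le> L * ln L\<close>, consider the sample \<open>(1, \<dots>, 1)\<close>. The assumption
  at the Dirac mass at 1 forces the estimate there to put mass at most \<open>\<kappa> * d / n\<close> outside 1, hence
  at most \<open>\<kappa> * d / (n * (d - 1))\<close> on some \<open>j \<noteq> 1\<close>. Under the law with mass \<open>L / (2 * n)\<close> at \<open>j\<close> and the
  rest at 1 this sample still has probability at least \<open>\<delta>\<close>, and the loss is at least
  \<open>L * ln L / (8 * n)\<close>. If \<open>d \<ge> L * ln L\<close>, Assouad's argument over perturbations of the uniform
  law gives a loss of order \<open>d / n\<close> with probability at least \<open>1 / 16\<close>, for any estimator.\<close>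

section \<open>Divergence as a real sum, and the law of the sample\<close>

lemma KL_eq:
  "KL d P Q = (if \<exists>j\<in>{1..d}. pmf P j \<noteq> 0 \<and> pmf Q j = 0 then \<infinity>
     else ereal (\<Sum>j = 1..d. pmf P j * ln (pmf P j / pmf Q j)))"
proof (cases "\<exists>j\<in>{1..d}. pmf P j \<noteq> 0 \<and> pmf Q j = 0")
  case True
  then show ?thesis by (auto simp: KL_def sum_Pinfty)
next
  case False
  then have "KL d P Q = (\<Sum>j = 1..d. ereal (pmf P j * ln (pmf P j / pmf Q j)))"
    unfolding KL_def by (intro sum.cong) auto
  with False show ?thesis by (simp add: sum_ereal)
qed

lemma pmf_exists_of_weights:
  fixes f :: "'a \<Rightarrow> real"
  assumes "finite A" "\<And>x. x \<in> A \<Longrightarrow> f x \<ge> 0" "sum f A = 1"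
  obtains P where "set_pmf P \<subseteq> A" "\<And>x. x \<in> A \<Longrightarrow> pmf P x = f x"
proof -
  define g where "g x = (if x \<in> A then f x else 0)" for x
  have g0: "g x \<ge> 0" for x using assms(2) by (simp add: g_def)
  have "(\<integral>\<^sup>+x. ennreal (g x) \<partial>count_space UNIV) = (\<Sum>x\<in>A. ennreal (g x))"
    by (rule nn_integral_count_space'[OF \<open>finite A\<close>]) (auto simp: g_def)
  also have "\<dots> = ennreal (sum g A)" using g0 by (simp add: sum_ennreal)
  also have "sum g A = 1" using assms(3) by (simp add: g_def)
  finally have "(\<integral>\<^sup>+x. ennreal (g x) \<partial>count_space UNIV) = 1" by simp
  then have pg: "pmf (embed_pmf g) x = g x" for x
    using g0 by (intro pmf_embed_pmf) auto
  show ?thesis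
  proof (rule that[of "embed_pmf g"])
    show "set_pmf (embed_pmf g) \<subseteq> A"
      by (auto simp: set_pmf_iff pg g_def split: if_splits)
    show "pmf (embed_pmf g) x = f x" if "x \<in> A" for x using that by (simp add: pg g_def)
  qed
qed

lemma sum_pmf_prob_vectors:
  assumes "P \<in> prob_vectors d"
  shows "(\<Sum>j = 1..d. pmf P j) = 1"
  using assms by (intro sum_pmf_eq_1) (auto simp: prob_vectors_def)

text \<open>Extensionality makes \<open>x\<close> equal to \<open>undefined\<close> outside
  \<open>{1..n}\<close>, which is the default value in \<open>sample_pmf\<close>; otherwise the mass
  would be 0.\<close>

lemma pmf_sample_pmf:
  assumes "x \<in> {1..n} \<rightarrow>\<^sub>E S"
  shows "pmf (sample_pmf n P) x = (\<Prod>k = 1..n. pmf P (x k))"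
  using assms unfolding sample_pmf_def by (subst pmf_Pi) (auto simp: PiE_def extensional_def)

section \<open>Hellinger distance and affinity of product laws\<close>

text \<open>Applying \<open>ln t \<le> t - 1\<close> at \<open>t = sqrt q / sqrt p\<close> gives
  \<open>p * ln (p / q) \<ge> 2 * (p - sqrt p * sqrt q)\<close>. Summed over probability vectors,
  the right side is the unnormalised squared Hellinger distance.\<close>

lemma KL_ge_hellinger:
  assumes P: "P \<in> prob_vectors d" and Q: "Q \<in> prob_vectors d"
  shows "KL d P Q \<ge> ereal (\<Sum>j = 1..d. (sqrt (pmf P j) - sqrt (pmf Q j))\<^sup>2)"
proof (cases "\<exists>j\<in>{1..d}. pmf P j \<noteq> 0 \<and> pmf Q j = 0")
  case True
  then show ?thesis by (simp add: KL_eq)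
next
  case False
  have summand: "p * ln (p / q) \<ge> 2 * (p - sqrt p * sqrt q)"
    if "p \<ge> 0" "q \<ge> 0" "p \<noteq> 0 \<longrightarrow> q \<noteq> 0" for p q :: real
  proof (cases "p = 0")
    case False
    with that have pq: "p > 0" "q > 0" by auto
    have "ln (sqrt q / sqrt p) \<le> sqrt q / sqrt p - 1"
      using pq by (intro ln_le_minus_one) auto
    moreover have "ln (sqrt q / sqrt p) = - ln (p / q) / 2"
      using pq by (simp add: ln_div ln_sqrt)
    ultimately have "ln (p / q) \<ge> 2 * (1 - sqrt q / sqrt p)" by simp
    then have "p * ln (p / q) \<ge> p * (2 * (1 - sqrt q / sqrt p))"
      using pq by (intro mult_left_mono) auto
    moreover have "p * (sqrt q / sqrt p) = sqrt p * sqrt q"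
      using pq by (simp add: real_div_sqrt field_simps)
    moreover have "p * (2 * (1 - sqrt q / sqrt p)) = 2 * (p - p * (sqrt q / sqrt p))"
      by (simp add: algebra_simps)
    ultimately show ?thesis by simp
  qed simp
  \<comment> \<open>The extra term \<open>pmf Q j - pmf P j\<close> sums to 0, both total masses
    being 1.\<close>
  have "(\<Sum>j = 1..d. (sqrt (pmf P j) - sqrt (pmf Q j))\<^sup>2)
      = (\<Sum>j = 1..d. 2 * (pmf P j - sqrt (pmf P j) * sqrt (pmf Q j)) + (pmf Q j - pmf P j))"
    by (intro sum.cong) (auto simp: power2_diff)
  also have "\<dots> = (\<Sum>j = 1..d. 2 * (pmf P j - sqrt (pmf P j) * sqrt (pmf Q j)))"
    by (simp only: sum.distrib sum_subtractf sum_pmf_prob_vectors[OF P] sum_pmf_prob_vectors[OF Q]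
        diff_self add_0_right)
  also have "\<dots> \<le> (\<Sum>j = 1..d. pmf P j * ln (pmf P j / pmf Q j))"
    using False by (intro sum_mono summand) auto
  finally show ?thesis using False by (simp add: KL_eq)
qed

text \<open>Le Cam's inequality: write \<open>f * g\<close> as \<open>min * max\<close>, apply
  Cauchy-Schwarz, and bound the sum of the maxima by 2.\<close>

lemma sum_min_ge_affinity:
  fixes f g :: "'a \<Rightarrow> real"
  assumes "\<And>x. x \<in> X \<Longrightarrow> f x \<ge> 0" "\<And>x. x \<in> X \<Longrightarrow> g x \<ge> 0" "sum f X = 1" "sum g X = 1"
  shows "(\<Sum>x\<in>X. sqrt (f x * g x))\<^sup>2 / 2 \<le> (\<Sum>x\<in>X. min (f x) (g x))"
proof -
  have "(\<Sum>x\<in>X. sqrt (f x * g x)) = (\<Sum>x\<in>X. sqrt (min (f x) (g x)) * sqrt (max (f x) (g x)))"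
    by (intro sum.cong) (auto simp: real_sqrt_mult[symmetric] min_def max_def mult.commute)
  also have "\<dots>\<^sup>2 \<le> (\<Sum>x\<in>X. (sqrt (min (f x) (g x)))\<^sup>2) * (\<Sum>x\<in>X. (sqrt (max (f x) (g x)))\<^sup>2)"
    by (rule Cauchy_Schwarz_ineq_sum)
  also have "\<dots> = (\<Sum>x\<in>X. min (f x) (g x)) * (\<Sum>x\<in>X. max (f x) (g x))"
    using assms(1,2) by (intro arg_cong2[of _ _ _ _ "(*)"] sum.cong) (auto simp: max_def min_def)
  also have "\<dots> \<le> (\<Sum>x\<in>X. min (f x) (g x)) * (\<Sum>x\<in>X. f x + g x)"
    using assms(1,2) by (intro mult_left_mono sum_mono sum_nonneg) (auto simp: max_def)
  also have "(\<Sum>x\<in>X. f x + g x) = 2" by (simp add: sum.distrib assms)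
  finally show ?thesis by simp
qed

lemma real_sqrt_prod:
  fixes f :: "'a \<Rightarrow> real"
  shows "sqrt (prod f A) = (\<Prod>x\<in>A. sqrt (f x))"
  by (induction A rule: infinite_finite_induct) (auto simp: real_sqrt_mult)

text \<open>The affinity is multiplicative over independent coordinates, so \<open>n\<close> samples
  raise it to the power \<open>n\<close>, and Le Cam's inequality squares it.\<close>

lemma sum_min_prod_ge:
  fixes p q :: "'a \<Rightarrow> real"
  assumes J: "finite J" and p: "\<And>j. j \<in> J \<Longrightarrow> p j \<ge> 0" and q: "\<And>j. j \<in> J \<Longrightarrow> q j \<ge> 0"
    and "sum p J = 1" "sum q J = 1"
  shows "(\<Sum>j\<in>J. sqrt (p j * q j)) ^ (2 * n) / 2
    \<le> (\<Sum>x\<in>{1..n} \<rightarrow>\<^sub>E J. min (\<Prod>k=1..n. p (x k)) (\<Prod>k=1..n. q (x k)))"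
proof -
  \<comment> \<open>Applied to \<open>sqrt (p j * q j)\<close> this tensorises the affinity; applied
    to \<open>p\<close> and \<open>q\<close> it shows that the product weights have total mass
    1.\<close>
  have tensor: "(\<Sum>x\<in>{1..n} \<rightarrow>\<^sub>E J. \<Prod>k=1..n. r (x k)) = sum r J ^ n" for r :: "'a \<Rightarrow> real"
    using J by (subst prod_sum_PiE[symmetric]) auto
  have "(\<Sum>x\<in>{1..n} \<rightarrow>\<^sub>E J. sqrt ((\<Prod>k=1..n. p (x k)) * (\<Prod>k=1..n. q (x k))))
    = (\<Sum>x\<in>{1..n} \<rightarrow>\<^sub>E J. \<Prod>k=1..n. sqrt (p (x k) * q (x k)))"
    by (intro sum.cong refl) (simp add: prod.distrib[symmetric] real_sqrt_prod)
  also have "\<dots> = (\<Sum>j\<in>J. sqrt (p j * q j)) ^ n" by (rule tensor)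
  finally have aff: "(\<Sum>x\<in>{1..n} \<rightarrow>\<^sub>E J. sqrt ((\<Prod>k=1..n. p (x k)) * (\<Prod>k=1..n. q (x k))))
    = (\<Sum>j\<in>J. sqrt (p j * q j)) ^ n" .
  have "(\<Sum>x\<in>{1..n} \<rightarrow>\<^sub>E J. sqrt ((\<Prod>k=1..n. p (x k)) * (\<Prod>k=1..n. q (x k))))\<^sup>2 / 2
    \<le> (\<Sum>x\<in>{1..n} \<rightarrow>\<^sub>E J. min (\<Prod>k=1..n. p (x k)) (\<Prod>k=1..n. q (x k)))"
    by (rule sum_min_ge_affinity, unfold tensor) (auto simp: assms intro!: prod_nonneg p q)
  then show ?thesis unfolding aff by (simp add: power_mult[symmetric] mult.commute)
qed

subsection \<open>Rare observations\<close>

text \<open>The divergence from the Dirac mass is \<open>ln (1 / q)\<close> with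
  \<open>q = pmf Q 1\<close>, hence at least \<open>1 - q\<close>. So \<open>Q\<close> has mass at
  most \<open>c\<close> off 1, and one of the \<open>d - 1\<close> other points carries at most the
  average.\<close>

lemma exists_small_coordinate:
  fixes Q :: "nat pmf"
  assumes "d \<ge> 2" "Q \<in> prob_vectors d" "KL d (return_pmf 1) Q \<le> ereal c"
  obtains j where "j \<in> {2..d}" "pmf Q j \<le> c / real (d - 1)"
proof -
  let ?q = "pmf Q 1"
  have q: "?q \<noteq> 0"
    using assms by (auto simp: KL_eq indicator_def split: if_splits)
  have ex: "\<not> (\<exists>j\<in>{1..d}. pmf (return_pmf 1) j \<noteq> 0 \<and> pmf Q j = 0)"
    using q by (auto simp: indicator_def)
  have "KL d (return_pmf 1) Q
      = ereal (\<Sum>j = 1..d. pmf (return_pmf 1) j * ln (pmf (return_pmf 1) j / pmf Q j))"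
    unfolding KL_eq using ex by (rule if_not_P)
  also have "(\<Sum>j = 1..d. pmf (return_pmf 1) j * ln (pmf (return_pmf 1) j / pmf Q j))
     = (\<Sum>j \<in> {1}. ln (1 / pmf Q j))"
    using \<open>d \<ge> 2\<close> by (intro sum.mono_neutral_cong_right) (auto simp: indicator_def)
  finally have "ln (1 / ?q) \<le> c" using assms(3) by simp
  moreover have "ln ?q \<le> ?q - 1" using q by (intro ln_le_minus_one) (simp add: pmf_pos)
  ultimately have c: "1 - ?q \<le> c" using q by (simp add: ln_div)
  have "{1..d} = insert 1 {2..d}" using \<open>d \<ge> 2\<close> by auto
  then have "?q + (\<Sum>j = 2..d. pmf Q j) = 1"
    using sum_pmf_prob_vectors[OF assms(2)] by simp
  with c have s: "(\<Sum>j = 2..d. pmf Q j) \<le> c" by simp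
  show ?thesis
  proof (rule ccontr)
    assume "\<not> thesis"
    then have "\<And>j. j \<in> {2..d} \<Longrightarrow> c / real (d - 1) < pmf Q j" using that by force
    then have "(\<Sum>j = 2..d. c / real (d - 1)) < (\<Sum>j = 2..d. pmf Q j)"
      using \<open>d \<ge> 2\<close> by (intro sum_strict_mono) auto
    with s \<open>d \<ge> 2\<close> show False by simp
  qed
qed

text \<open>The term at \<open>j\<close> is at least \<open>s * ln (s / b)\<close>. The term at 1
  may be negative, but not below \<open>- s\<close>, because \<open>Q\<close> has mass at most 1
  there.\<close>

lemma KL_two_point_ge:
  assumes Q: "Q \<in> prob_vectors d" and j: "j \<in> {2..d}" and s: "0 < s" "s < 1"
    and P1: "pmf P 1 = 1 - s" and Pj: "pmf P j = s"
    and P0: "\<And>k. k \<in> {1..d} - {1, j} \<Longrightarrow> pmf P k = 0"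
    and b: "pmf Q j \<le> b"
  shows "KL d P Q \<ge> ereal (s * (ln (s / b) - 1))"
proof (cases "\<exists>j\<in>{1..d}. pmf P j \<noteq> 0 \<and> pmf Q j = 0")
  case True
  then show ?thesis by (simp add: KL_eq)
next
  case False
  have "pmf Q 1 \<noteq> 0" "pmf Q j \<noteq> 0"
    using False j s P1 Pj by force+
  then have q: "pmf Q 1 > 0" "pmf Q j > 0" by (simp_all add: pmf_pos)
  have "(\<Sum>k = 1..d. pmf P k * ln (pmf P k / pmf Q k))
     = (\<Sum>k \<in> {1, j}. pmf P k * ln (pmf P k / pmf Q k))"
    using j P0 by (intro sum.mono_neutral_right) auto
  also have "\<dots> = (1 - s) * ln ((1 - s) / pmf Q 1) + s * ln (s / pmf Q j)"
    using j P1 Pj by simp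
  finally have eq: "KL d P Q = ereal ((1 - s) * ln ((1 - s) / pmf Q 1) + s * ln (s / pmf Q j))"
    using False by (simp add: KL_eq)
  have "ln (pmf Q 1 / (1 - s)) \<le> pmf Q 1 / (1 - s) - 1"
    using q s by (intro ln_le_minus_one) auto
  then have "(1 - s) * ln (pmf Q 1 / (1 - s)) \<le> (1 - s) * (pmf Q 1 / (1 - s) - 1)"
    using s by (intro mult_left_mono) auto
  also have "\<dots> = pmf Q 1 - (1 - s)" using s by (simp add: field_simps)
  also have "\<dots> \<le> s" using pmf_le_1[of Q 1] by linarith
  finally have 1: "(1 - s) * ln ((1 - s) / pmf Q 1) \<ge> - s"
    using q s by (simp add: ln_div algebra_simps)
  have "s * ln (s / pmf Q j) \<ge> s * ln (s / b)"
    using q s b by (intro mult_left_mono ln_mono divide_left_mono) auto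
  with 1 show ?thesis by (simp add: eq algebra_simps)
qed

text \<open>The constant sample remains likely enough when mass \<open>L / (2 * n)\<close> is moved
  to a point that the estimator, seeing this sample, almost ignores.\<close>

lemma rare_observation_lower_bound:
  fixes n d :: nat and L b :: real
  assumes "d \<ge> 2" and L: "0 < L" "L < real n" and Phi: "\<Phi> \<in> ({1..n} \<rightarrow>\<^sub>E {1..d}) \<rightarrow> prob_vectors d"
    and pos: "measure_pmf.prob (sample_pmf n (return_pmf 1)) {x. KL d (return_pmf 1) (\<Phi> x) \<le> ereal c} > 0"
  shows "\<exists>P \<in> prob_vectors d. measure_pmf.prob (sample_pmf n P)
     {x. KL d P (\<Phi> x) \<ge> ereal (L / (2 * real n) * (ln (L / (2 * real n) / (c / real (d - 1))) - 1))} \<ge> exp (- L)"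
proof -
  \<comment> \<open>The value \<open>undefined\<close> outside \<open>{1..n}\<close> matches
    \<open>sample_pmf\<close>. The sample law at the Dirac mass is then concentrated on
    \<open>o1\<close>, so positive probability forces the event to hold at \<open>o1\<close>
    itself.\<close>
  define o1 where "o1 = (\<lambda>k. if k \<in> {1..n} then 1 else undefined :: nat)"
  have o1: "o1 \<in> {1..n} \<rightarrow>\<^sub>E {1..d}" using \<open>d \<ge> 2\<close> by (auto simp: o1_def)
  have Q: "\<Phi> o1 \<in> prob_vectors d" using Phi o1 by auto
  have "sample_pmf n (return_pmf 1) = return_pmf o1"
    unfolding sample_pmf_def o1_def by (subst Pi_pmf_return_pmf) auto
  with pos have "KL d (return_pmf 1) (\<Phi> o1) \<le> ereal c"
    by (simp add: indicator_def split: if_splits)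
  then obtain j where j: "j \<in> {2..d}" and b: "pmf (\<Phi> o1) j \<le> c / real (d - 1)"
    using exists_small_coordinate[OF \<open>d \<ge> 2\<close> Q] by blast
  \<comment> \<open>The factor 2 pays for \<open>exp (- 2 * s) \<le> 1 - s\<close>, valid since
    \<open>L < n\<close> gives \<open>s < 1/2\<close>; then
    \<open>(1 - s) ^ n \<ge> exp (- L)\<close>.\<close>
  define s where "s = L / (2 * real n)"
  have s: "0 < s" "s < 1/2" using L by (auto simp: s_def field_simps)
  define f where "f k = (if k = 1 then 1 - s else if k = j then s else 0)" for k :: nat
  have "sum f {1..d} = sum f {1, j}"
    using j by (intro sum.mono_neutral_right) (auto simp: f_def)
  also have "\<dots> = 1" using j by (auto simp: f_def)
  finally have f1: "sum f {1..d} = 1" .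
  have "f k \<ge> 0" for k using s by (simp add: f_def)
  then obtain P where P: "set_pmf P \<subseteq> {1..d}" "\<And>k. k \<in> {1..d} \<Longrightarrow> pmf P k = f k"
    using pmf_exists_of_weights[OF _ _ f1] by blast
  have kl: "KL d P (\<Phi> o1) \<ge> ereal (s * (ln (s / (c / real (d - 1))) - 1))"
    using j s P(2) by (intro KL_two_point_ge[OF Q j _ _ _ _ _ b]) (auto simp: f_def)
  have "exp (- 2 * s) \<le> 1 - s"
  proof -
    \<comment> \<open>The left side equals \<open>1 / (1 - s)\<close>, and
      \<open>s / (1 - s) \<le> 2 * s\<close>.\<close>
    have "1 + s / (1 - s) \<le> exp (s / (1 - s))" by (rule exp_ge_add_one_self)
    also have "\<dots> \<le> exp (2 * s)" using s by (simp add: field_simps)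
    finally have "1 / (1 - s) \<le> exp (2 * s)" using s by (simp add: field_simps)
    then have "1 / exp (2 * s) \<le> 1 - s" using s by (simp add: field_simps)
    then show ?thesis by (simp add: exp_minus inverse_eq_divide)
  qed
  then have "exp (- 2 * s) ^ n \<le> (1 - s) ^ n" by (intro power_mono) auto
  moreover have "exp (- 2 * s) ^ n = exp (- L)"
    using L by (simp add: exp_of_nat_mult[symmetric] s_def)
  moreover have "pmf (sample_pmf n P) o1 = (1 - s) ^ n"
    using P(2)[of 1] \<open>d \<ge> 2\<close> by (subst pmf_sample_pmf[OF o1]) (simp add: o1_def f_def)
  moreover have "pmf (sample_pmf n P) o1
    \<le> measure_pmf.prob (sample_pmf n P) {x. KL d P (\<Phi> x) \<ge> ereal (s * (ln (s / (c / real (d - 1))) - 1))}"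
    unfolding measure_pmf_single[symmetric] using kl by (intro measure_pmf.finite_measure_mono) auto
  ultimately show ?thesis using P(1) unfolding s_def prob_vectors_def by (intro bexI[of _ P]) auto
qed

subsection \<open>Perturbations of the uniform distribution\<close>

text \<open>Coordinates are paired as \<open>(i, i + m)\<close>. Within a pair, mass
  \<open>\<epsilon> / d\<close> moves to one side, chosen by whether \<open>i \<in> S\<close>; the
  total \<open>2 / d\<close> of the pair does not depend on \<open>S\<close>. Points beyond
  \<open>2 * m\<close> keep their uniform mass.\<close>

definition perturbed :: "nat \<Rightarrow> nat \<Rightarrow> real \<Rightarrow> nat set \<Rightarrow> nat \<Rightarrow> real" where
  "perturbed d m \<epsilon> S j =
     (if j \<in> {1..m} then if j \<in> S then 1 + \<epsilon> else 1 - \<epsilon>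
      else if j \<in> {m+1..2*m} then if j - m \<in> S then 1 - \<epsilon> else 1 + \<epsilon> else 1) / real d"

lemma sum_pairs:
  fixes f :: "nat \<Rightarrow> real"
  assumes "2 * m \<le> d"
  shows "sum f {1..d} = (\<Sum>i=1..m. f i + f (i + m)) + sum f {2*m+1..d}"
proof -
  have "sum f {1..d} = sum f {1..2*m} + sum f {2*m+1..d}"
    using assms by (metis le_add1 sum.ub_add_nat le_add_diff_inverse Suc_eq_plus1 le_add2)
  moreover have "sum f {1..2*m} = sum f {1..m} + sum f {m+1..m+m}"
    using sum.ub_add_nat[of 1 m f m] by (simp add: mult_2)
  moreover have "sum f {m+1..m+m} = (\<Sum>i=1..m. f (i + m))"
    using sum.shift_bounds_cl_nat_ivl[of f 1 m m] by (simp add: add.commute)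
  ultimately show ?thesis by (simp add: sum.distrib)
qed

lemma sum_perturbed:
  assumes "2 * m \<le> d" "d > 0"
  shows "(\<Sum>j=1..d. perturbed d m \<epsilon> S j) = 1"
proof -
  have "(\<Sum>j=1..d. perturbed d m \<epsilon> S j)
    = (\<Sum>i=1..m. 2 / real d) + (\<Sum>j=2*m+1..d. 1 / real d)"
    unfolding sum_pairs[OF assms(1)]
    by (intro arg_cong2[of _ _ _ _ "(+)"] sum.cong) (auto simp: perturbed_def add_divide_distrib[symmetric])
  also have "\<dots> = 1" using assms by (simp add: field_simps of_nat_diff)
  finally show ?thesis .
qed

lemma perturbed_pos:
  assumes "0 \<le> \<epsilon>" "\<epsilon> < 1" "d > 0"
  shows "perturbed d m \<epsilon> S j > 0"
  using assms by (auto simp: perturbed_def)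

text \<open>Toggling \<open>i\<close> only swaps the masses at \<open>i\<close> and
  \<open>i + m\<close>. At both points the geometric mean is
  \<open>sqrt (1 - \<epsilon>\<^sup>2) / d\<close>, at least
  \<open>(1 - \<epsilon>\<^sup>2) / d\<close>.\<close>

lemma affinity_perturbed:
  assumes "2 * m \<le> d" "d > 0" "0 \<le> \<epsilon>" "\<epsilon> < 1" "i \<in> {1..m}"
    and S': "S' = sym_diff S {i}"
  shows "(\<Sum>j=1..d. sqrt (perturbed d m \<epsilon> S j * perturbed d m \<epsilon> S' j)) \<ge> 1 - 2 * \<epsilon>\<^sup>2 / d"
proof -
  let ?p = "perturbed d m \<epsilon> S" and ?q = "perturbed d m \<epsilon> S'"
  have "1 - \<epsilon>\<^sup>2 \<le> sqrt (1 - \<epsilon>\<^sup>2)"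
  proof (rule real_le_rsqrt)
    have "(1 - \<epsilon>\<^sup>2)\<^sup>2 \<le> (1 - \<epsilon>\<^sup>2) * 1"
      unfolding power2_eq_square[of "1 - \<epsilon>\<^sup>2"] using assms
      by (intro mult_left_mono) (auto simp: abs_square_le_1)
    then show "(1 - \<epsilon>\<^sup>2)\<^sup>2 \<le> 1 - \<epsilon>\<^sup>2" by simp
  qed
  then have sq: "sqrt ((1 + \<epsilon>) * (1 - \<epsilon>)) \<ge> 1 - \<epsilon>\<^sup>2"
    by (simp add: power2_eq_square algebra_simps)
  \<comment> \<open>The left side is \<open>(1 - \<epsilon>\<^sup>2) / d\<close> on the toggled pair
    and \<open>?p j\<close> elsewhere. In this form its sum is 1 minus a sum over two
    points.\<close>
  have "?p j - (if j \<in> {i, i + m} then (?p j - (1 - \<epsilon>\<^sup>2) / d) else 0) \<le> sqrt (?p j * ?q j)" for j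
  proof (cases "j \<in> {i, i + m}")
    case True
    then have "?p j * ?q j = ((1 + \<epsilon>) * (1 - \<epsilon>)) / (real d)\<^sup>2"
      using assms by (auto simp: perturbed_def power2_eq_square)
    then have "sqrt (?p j * ?q j) = sqrt ((1 + \<epsilon>) * (1 - \<epsilon>)) / d"
      by (simp add: real_sqrt_divide)
    with sq True show ?thesis by (simp add: divide_right_mono)
  next
    case False
    then have "?q j = ?p j" by (auto simp: perturbed_def S')
    with False perturbed_pos[of \<epsilon> d m S j] assms show ?thesis by simp
  qed
  then have "(\<Sum>j=1..d. ?p j - (if j \<in> {i, i + m} then (?p j - (1 - \<epsilon>\<^sup>2) / d) else 0))
     \<le> (\<Sum>j=1..d. sqrt (?p j * ?q j))" by (intro sum_mono)
  moreover have "(\<Sum>j=1..d. if j \<in> {i, i + m} then (?p j - (1 - \<epsilon>\<^sup>2) / d) else 0)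
     = (\<Sum>j\<in>{i, i + m}. ?p j - (1 - \<epsilon>\<^sup>2) / d)"
    using assms by (intro sum.mono_neutral_cong_right) auto
  moreover have "(\<Sum>j\<in>{i, i + m}. ?p j - (1 - \<epsilon>\<^sup>2) / d) = 2 * \<epsilon>\<^sup>2 / d"
  proof -
    have "?p i + ?p (i + m) = 2 / d"
      using assms by (auto simp: perturbed_def add_divide_distrib[symmetric])
    then show ?thesis using assms by (simp add: diff_divide_distrib)
  qed
  ultimately show ?thesis using sum_perturbed[OF assms(1,2)] by (simp add: sum_subtractf)
qed

text \<open>The symmetric difference is the set of pairs \<open>(i, i + m)\<close> that \<open>Q\<close> orders wrongly.\<close>

lemma KL_perturbed_ge:
  assumes "2 * m \<le> d" "d > 0" "0 \<le> \<epsilon>" "\<epsilon> < 1" and S: "S \<subseteq> {1..m}"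
    and P: "P \<in> prob_vectors d" and Q: "Q \<in> prob_vectors d"
    and p: "\<And>j. j \<in> {1..d} \<Longrightarrow> pmf P j = perturbed d m \<epsilon> S j"
  shows "KL d P Q \<ge> ereal (card (sym_diff S {i\<in>{1..m}. pmf Q i > pmf Q (i + m)}) * (\<epsilon>\<^sup>2 / (2 * real d)))"
proof -
  let ?h = "\<lambda>j. (sqrt (pmf P j) - sqrt (pmf Q j))\<^sup>2"
  let ?E = "sym_diff S {i\<in>{1..m}. pmf Q i > pmf Q (i + m)}"
  \<comment> \<open>Fitting a decreasing pair \<open>a\<close>, \<open>b\<close> by an increasing
    pair \<open>u\<close>, \<open>v\<close> costs at least as much as fitting both by their
    midpoint.\<close>
  have two: "(a - b)\<^sup>2 / 2 \<le> (a - u)\<^sup>2 + (b - v)\<^sup>2" if "b \<le> a" "u \<le> v" for a b u v :: real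
  proof -
    have "(a - b)\<^sup>2 \<le> ((a - u) + (v - b))\<^sup>2" using that by (intro power_mono) auto
    also have "\<dots> \<le> 2 * ((a - u)\<^sup>2 + (b - v)\<^sup>2)"
      using zero_le_power2[of "(a - u) - (v - b)"] by (simp add: power2_eq_square algebra_simps)
    finally show ?thesis by simp
  qed
  define a b where "a = sqrt ((1 + \<epsilon>) / d)" and "b = sqrt ((1 - \<epsilon>) / d)"
  have ab: "b \<le> a" unfolding a_def b_def using assms by (intro real_sqrt_le_mono divide_right_mono) auto
  have sq: "a\<^sup>2 = (1 + \<epsilon>) / d" "b\<^sup>2 = (1 - \<epsilon>) / d" using assms by (auto simp: a_def b_def)
  \<comment> \<open>Uses \<open>(a - b) * (a + b) = 2 * \<epsilon> / d\<close> together with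
    \<open>(a + b)\<^sup>2 \<le> 4 / d\<close>.\<close>
  have gap: "(a - b)\<^sup>2 \<ge> \<epsilon>\<^sup>2 / d"
  proof -
    have "(a + b)\<^sup>2 \<le> 2 * (a\<^sup>2 + b\<^sup>2)"
      using zero_le_power2[of "a - b"] by (simp add: power2_eq_square algebra_simps)
    also have "\<dots> = 4 / d" unfolding sq by (simp add: add_divide_distrib[symmetric])
    finally have "(a - b)\<^sup>2 * (a + b)\<^sup>2 \<le> (a - b)\<^sup>2 * (4 / d)" by (intro mult_left_mono) auto
    moreover have "(a - b)\<^sup>2 * (a + b)\<^sup>2 = (a\<^sup>2 - b\<^sup>2)\<^sup>2"
      by (simp add: power2_eq_square algebra_simps)
    moreover have "a\<^sup>2 - b\<^sup>2 = 2 * \<epsilon> / d" unfolding sq by (simp add: diff_divide_distrib[symmetric])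
    ultimately have "4 * \<epsilon>\<^sup>2 / (real d)\<^sup>2 \<le> (a - b)\<^sup>2 * (4 / d)"
      by (simp add: power_divide power_mult_distrib)
    then show ?thesis using \<open>d > 0\<close> by (simp add: field_simps power2_eq_square)
  qed
  have err: "?h i + ?h (i + m) \<ge> \<epsilon>\<^sup>2 / (2 * real d)" if i: "i \<in> ?E" for i
  proof -
    have im: "i \<in> {1..m}" using i S by auto
    have "?h i + ?h (i + m) \<ge> (a - b)\<^sup>2 / 2"
    proof (cases "i \<in> S")
      case True
      \<comment> \<open>A tie counts as \<open>i\<close> not selected. This is harmless, since
        \<open>two\<close> needs only weak inequalities.\<close>
      with i im have "pmf Q i \<le> pmf Q (i + m)" by auto
      moreover have "sqrt (pmf P i) = a" "sqrt (pmf P (i + m)) = b"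
        using True im assms(1) by (auto simp: p perturbed_def a_def b_def)
      ultimately show ?thesis using two[OF ab, of "sqrt (pmf Q i)" "sqrt (pmf Q (i + m))"] by simp
    next
      case False
      with i im have "pmf Q (i + m) \<le> pmf Q i" by auto
      moreover have "sqrt (pmf P i) = b" "sqrt (pmf P (i + m)) = a"
        using False im assms(1) by (auto simp: p perturbed_def a_def b_def)
      ultimately show ?thesis using two[OF ab, of "sqrt (pmf Q (i + m))" "sqrt (pmf Q i)"] by simp
    qed
    with gap show ?thesis by simp
  qed
  have "card ?E * (\<epsilon>\<^sup>2 / (2 * real d)) = (\<Sum>i\<in>?E. \<epsilon>\<^sup>2 / (2 * real d))" by simp
  also have "\<dots> \<le> (\<Sum>i\<in>?E. ?h i + ?h (i + m))" by (intro sum_mono err)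
  also have "\<dots> \<le> (\<Sum>i=1..m. ?h i + ?h (i + m))" using S by (intro sum_mono2) auto
  also have "\<dots> \<le> sum ?h {1..d}" unfolding sum_pairs[OF assms(1), of ?h]
    by (simp add: sum_nonneg)
  finally show ?thesis using KL_ge_hellinger[OF P Q] by (meson ereal_less_eq(3) order_trans)
qed

section \<open>Assouad's lemma and the minimax bound\<close>

text \<open>For each \<open>x\<close>, the guess \<open>T x\<close> errs at \<open>i\<close> for
  exactly one of \<open>S\<close> and \<open>sym_diff S {i}\<close>, so the two error weights add up
  to at least the overlap. Averaging over all \<open>S\<close> and summing over \<open>i\<close>
  gives the bound on average, hence for some \<open>S\<close>.\<close>

lemma assouad:
  fixes w :: "'i set \<Rightarrow> 'x \<Rightarrow> real" and T :: "'x \<Rightarrow> 'i set" and c :: real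
  assumes M: "finite M" and X: "finite X"
    and w: "\<And>S x. S \<subseteq> M \<Longrightarrow> x \<in> X \<Longrightarrow> w S x \<ge> 0"
    and T: "\<And>x. x \<in> X \<Longrightarrow> T x \<subseteq> M"
    and overlap: "\<And>S i. S \<subseteq> M \<Longrightarrow> i \<in> M \<Longrightarrow> (\<Sum>x\<in>X. min (w S x) (w (sym_diff S {i}) x)) \<ge> c"
  shows "\<exists>S\<subseteq>M. (\<Sum>x\<in>X. w S x * card (sym_diff S (T x))) \<ge> card M * c / 2"
proof (rule ccontr)
  assume neg: "\<not> ?thesis"
  define e where "e i S = (\<Sum>x\<in>X. w S x * of_bool (i \<in> sym_diff S (T x)))" for i S
  have pair: "2 * (\<Sum>S\<in>Pow M. e i S) \<ge> 2 ^ card M * c" if i: "i \<in> M" for i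
  proof -
    \<comment> \<open>Toggling \<open>i\<close> is an involution of \<open>Pow M\<close>, so each
      \<open>S\<close> can be paired with its neighbour.\<close>
    have "(\<Sum>S\<in>Pow M. e i S) = (\<Sum>S\<in>Pow M. e i (sym_diff S {i}))"
    proof (rule sum.reindex_bij_witness[of _ "\<lambda>S. sym_diff S {i}" "\<lambda>S. sym_diff S {i}"])
      fix S assume S: "S \<in> Pow M"
      show inv: "sym_diff (sym_diff S {i}) {i} = S" by blast
      show "sym_diff S {i} \<in> Pow M" using S i by blast
      show "e i (sym_diff (sym_diff S {i}) {i}) = e i S" by (simp only: inv)
    qed (use i in blast)+
    then have twice: "2 * (\<Sum>S\<in>Pow M. e i S) = (\<Sum>S\<in>Pow M. e i S + e i (sym_diff S {i}))"
      by (simp add: sum.distrib)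
    have "(\<Sum>S\<in>Pow M. c) \<le> (\<Sum>S\<in>Pow M. e i S + e i (sym_diff S {i}))"
    proof (rule sum_mono)
      fix S assume S: "S \<in> Pow M"
      have "c \<le> (\<Sum>x\<in>X. min (w S x) (w (sym_diff S {i}) x))" using overlap S i by auto
      also have "\<dots> \<le> (\<Sum>x\<in>X. w S x * of_bool (i \<in> sym_diff S (T x))
          + w (sym_diff S {i}) x * of_bool (i \<in> sym_diff (sym_diff S {i}) (T x)))"
      proof (rule sum_mono)
        fix x assume "x \<in> X"
        have aux: "min a b \<le> a * of_bool \<phi> + b * of_bool (\<not> \<phi>)" for a b :: real and \<phi>
          by (cases \<phi>) auto
        have flip: "i \<in> sym_diff (sym_diff S {i}) (T x) \<longleftrightarrow> i \<notin> sym_diff S (T x)" by blast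
        show "min (w S x) (w (sym_diff S {i}) x) \<le> w S x * of_bool (i \<in> sym_diff S (T x))
          + w (sym_diff S {i}) x * of_bool (i \<in> sym_diff (sym_diff S {i}) (T x))"
          unfolding flip by (rule aux)
      qed
      finally show "c \<le> e i S + e i (sym_diff S {i})" by (simp only: e_def sum.distrib)
    qed
    then show ?thesis unfolding twice[symmetric] using M by (simp add: card_Pow)
  qed
  have total: "(\<Sum>x\<in>X. w S x * card (sym_diff S (T x))) = (\<Sum>i\<in>M. e i S)" if "S \<subseteq> M" for S
  proof -
    have "(\<Sum>i\<in>M. e i S) = (\<Sum>x\<in>X. w S x * (\<Sum>i\<in>M. of_bool (i \<in> sym_diff S (T x))))"
      unfolding e_def by (subst sum.swap) (simp only: sum_distrib_left)
    also have "\<dots> = (\<Sum>x\<in>X. w S x * card (sym_diff S (T x)))"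
    proof (intro sum.cong refl arg_cong2[of _ _ _ _ "(*)"])
      fix x assume "x \<in> X"
      then have "sym_diff S (T x) \<subseteq> M" using T that by blast
      then have "M \<inter> {i. i \<in> sym_diff S (T x)} = sym_diff S (T x)" by blast
      then show "(\<Sum>i\<in>M. of_bool (i \<in> sym_diff S (T x))) = real (card (sym_diff S (T x)))"
        using M by (simp only: sum_of_bool_eq)
    qed
    finally show ?thesis by simp
  qed
  have "(\<Sum>S\<in>Pow M. \<Sum>i\<in>M. e i S) < (\<Sum>S\<in>Pow M. card M * c / 2)"
  proof (rule sum_strict_mono)
    fix S assume "S \<in> Pow M"
    then have "S \<subseteq> M" by simp
    with neg have "\<not> (\<Sum>x\<in>X. w S x * card (sym_diff S (T x))) \<ge> card M * c / 2" by blast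
    then show "(\<Sum>i\<in>M. e i S) < card M * c / 2" unfolding total[OF \<open>S \<subseteq> M\<close>] by simp
  qed (use M in auto)
  also have "\<dots> = card M * (2 ^ card M * c) / 2" using M by (simp add: card_Pow)
  also have "\<dots> = (\<Sum>i\<in>M. 2 ^ card M * c) / 2" by simp
  also have "\<dots> \<le> (\<Sum>i\<in>M. 2 * (\<Sum>S\<in>Pow M. e i S)) / 2"
    using pair by (intro divide_right_mono sum_mono) auto
  also have "\<dots> = (\<Sum>S\<in>Pow M. \<Sum>i\<in>M. e i S)"
    by (subst sum.swap) (simp add: sum_distrib_left[symmetric])
  finally show False by simp
qed

text \<open>Reverse Markov inequality: values below \<open>a\<close> contribute at most
  \<open>a\<close> to the mean, and the others at most \<open>b\<close> times their weight.\<close>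

lemma sum_tail_ge:
  fixes w N :: "'x \<Rightarrow> real"
  assumes X: "finite X" and w: "\<And>x. x \<in> X \<Longrightarrow> w x \<ge> 0" "sum w X = 1"
    and N: "\<And>x. x \<in> X \<Longrightarrow> N x \<le> b" and "b > 0" "a \<ge> 0" and mean: "(\<Sum>x\<in>X. w x * N x) \<ge> \<mu>"
  shows "sum w {x\<in>X. N x \<ge> a} \<ge> (\<mu> - a) / b"
proof -
  have "\<mu> \<le> (\<Sum>x\<in>X. w x * N x)" by (rule mean)
  also have "\<dots> \<le> (\<Sum>x\<in>X. a * w x + b * (if N x \<ge> a then w x else 0))"
  proof (rule sum_mono)
    fix x assume x: "x \<in> X"
    show "w x * N x \<le> a * w x + b * (if N x \<ge> a then w x else 0)"
    proof (cases "N x \<ge> a")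
      case True
      have "w x * N x \<le> w x * b" using w(1) N x by (intro mult_left_mono) auto
      moreover have "0 \<le> a * w x" using w(1) x \<open>a \<ge> 0\<close> by simp
      ultimately show ?thesis using True by (simp add: mult.commute)
    next
      case False
      then have "w x * N x \<le> w x * a" using w(1) x by (intro mult_left_mono) auto
      then show ?thesis using False by (simp add: mult.commute)
    qed
  qed
  also have "\<dots> = a + b * sum w {x\<in>X. N x \<ge> a}"
    using X w(2) by (simp add: sum.distrib sum_distrib_left[symmetric] sum.inter_filter)
  finally show ?thesis using \<open>b > 0\<close> by (simp add: field_simps)
qed

lemma minimax_lower_bound:
  fixes n d :: nat
  assumes d: "d \<ge> 4000" and n: "n \<ge> d" and Phi: "\<Phi> \<in> ({1..n} \<rightarrow>\<^sub>E {1..d}) \<rightarrow> prob_vectors d"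
  shows "\<exists>P \<in> prob_vectors d. measure_pmf.prob (sample_pmf n P)
     {x. KL d P (\<Phi> x) \<ge> ereal (real d / (600 * real n))} \<ge> 1 / 16"
proof -
  define m where "m = d div 2"
  have m: "2 * m \<le> d" "m > 0" "real m \<ge> (real d - 1) / 2" using d by (auto simp: m_def)
  \<comment> \<open>This makes the loss of affinity \<open>2 * \<epsilon>\<^sup>2 / d\<close> equal
    to \<open>1 / (4 * n)\<close>, so neighbouring laws stay hard to tell apart after
    \<open>n\<close> samples; \<open>n \<ge> d\<close> keeps \<open>\<epsilon>\<close> below
    1.\<close>
  define \<epsilon> where "\<epsilon> = sqrt (real d / (8 * real n))"
  have e2: "\<epsilon>\<^sup>2 = real d / (8 * real n)" by (simp add: \<epsilon>_def)
  have e: "0 \<le> \<epsilon>" "\<epsilon> < 1" using d n by (auto simp: \<epsilon>_def)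
  have d0: "d > 0" using d by simp
  let ?X = "{1..n} \<rightarrow>\<^sub>E {1..d}"
  have X: "finite ?X" by (intro finite_PiE) auto
  define w where "w S x = (\<Prod>k=1..n. perturbed d m \<epsilon> S (x k))" for S and x :: "nat \<Rightarrow> nat"
  define T where "T x = {i\<in>{1..m}. pmf (\<Phi> x) i > pmf (\<Phi> x) (i + m)}" for x
  note pos = perturbed_pos[OF e d0, THEN less_imp_le]
  have w0: "w S x \<ge> 0" for S x unfolding w_def by (intro prod_nonneg pos ballI)
  have w1: "(\<Sum>x\<in>?X. w S x) = 1" for S
    unfolding w_def by (subst prod_sum_PiE[symmetric]) (auto simp: sum_perturbed[OF m(1) d0, simplified])
  have "\<exists>S\<subseteq>{1..m}. (\<Sum>x\<in>?X. w S x * card (sym_diff S (T x))) \<ge> card {1..m} * (1/4) / 2"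
  proof (rule assouad)
    fix S i assume i: "i \<in> {1..m}"
    let ?S = "sym_diff S {i}"
    have "1 - 2 * \<epsilon>\<^sup>2 / d = 1 - 1 / (4 * real n)" using d0 by (simp add: e2)
    then have aff: "1 - 1 / (4 * real n)
       \<le> (\<Sum>j=1..d. sqrt (perturbed d m \<epsilon> S j * perturbed d m \<epsilon> ?S j))"
      using affinity_perturbed[OF m(1) d0 e i refl, of S] by simp
    \<comment> \<open>Bernoulli's inequality gives affinity power at least \<open>1/2\<close>, hence
      overlap at least \<open>1/4\<close>.\<close>
    have "1 + real (2 * n) * (- (1 / (4 * real n))) \<le> (1 + - (1 / (4 * real n))) ^ (2 * n)"
      using d n by (intro Bernoulli_inequality) (auto simp: field_simps)
    also have "\<dots> \<le> (\<Sum>j=1..d. sqrt (perturbed d m \<epsilon> S j * perturbed d m \<epsilon> ?S j)) ^ (2 * n)"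
      using aff d n by (intro power_mono) (auto simp: field_simps)
    finally have "1 / 4 \<le> (\<Sum>j=1..d. sqrt (perturbed d m \<epsilon> S j * perturbed d m \<epsilon> ?S j)) ^ (2 * n) / 2"
      using d n by simp
    also have "\<dots> \<le> (\<Sum>x\<in>?X. min (w S x) (w ?S x))"
      unfolding w_def by (intro sum_min_prod_ge pos sum_perturbed m d0) auto
    finally show "1 / 4 \<le> (\<Sum>x\<in>?X. min (w S x) (w ?S x))" .
  qed (use w0 X in \<open>auto simp: T_def\<close>)
  then obtain S where S: "S \<subseteq> {1..m}"
    and mean: "(\<Sum>x\<in>?X. w S x * card (sym_diff S (T x))) \<ge> real m / 8" by auto
  obtain P where P: "set_pmf P \<subseteq> {1..d}" "\<And>j. j \<in> {1..d} \<Longrightarrow> pmf P j = perturbed d m \<epsilon> S j"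
    using pmf_exists_of_weights[of "{1..d}" "perturbed d m \<epsilon> S"] pos sum_perturbed[OF m(1) d0]
    by auto
  have Pd: "P \<in> prob_vectors d" using P(1) by (simp add: prob_vectors_def)
  let ?A = "{x\<in>?X. real m / 16 \<le> card (sym_diff S (T x))}"
  \<comment> \<open>The mean number of errors is at least \<open>m / 8\<close> and the maximum is
    \<open>m\<close>; the threshold is half the bound on the mean.\<close>
  have "1 / 16 = (real m / 8 - real m / 16) / real m" using m by simp
  also have "\<dots> \<le> sum (w S) ?A"
  proof (rule sum_tail_ge[OF X w0 w1 _ _ _ mean])
    fix x
    have "T x \<subseteq> {1..m}" by (auto simp: T_def)
    then have "sym_diff S (T x) \<subseteq> {1..m}" using S by blast
    then show "real (card (sym_diff S (T x))) \<le> real m"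
      using card_mono[of "{1..m}" "sym_diff S (T x)"] by simp
  qed (use m in auto)
  also have "\<dots> = sum (pmf (sample_pmf n P)) ?A"
  proof (rule sum.cong[OF refl])
    fix x assume "x \<in> ?A"
    then have x: "x \<in> ?X" by simp
    then show "w S x = pmf (sample_pmf n P) x"
      unfolding w_def pmf_sample_pmf[OF x] by (intro prod.cong refl P(2)[symmetric]) auto
  qed
  also have "\<dots> = measure_pmf.prob (sample_pmf n P) ?A"
    using X by (subst measure_measure_pmf_finite) auto
  also have "\<dots> \<le> measure_pmf.prob (sample_pmf n P) {x. KL d P (\<Phi> x) \<ge> ereal (real d / (600 * real n))}"
  proof (intro measure_pmf.finite_measure_mono subsetI CollectI)
    fix x assume x: "x \<in> ?A"
    \<comment> \<open>The right side is \<open>m / (256 * n)\<close>, and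
      \<open>m \<ge> (d - 1) / 2\<close>; the slack between 512 and 600 absorbs the
      \<open>- 1\<close>.\<close>
    have "real d / (600 * real n) \<le> real m / 16 * (\<epsilon>\<^sup>2 / (2 * real d))"
      unfolding e2 using m d n by (simp add: field_simps)
    also have "\<dots> \<le> card (sym_diff S (T x)) * (\<epsilon>\<^sup>2 / (2 * real d))"
      using x by (intro mult_right_mono) auto
    also have "ereal \<dots> \<le> KL d P (\<Phi> x)"
      unfolding T_def using x Phi P(2) by (intro KL_perturbed_ge m d0 e S Pd) auto
    finally show "ereal (real d / (600 * real n)) \<le> KL d P (\<Phi> x)" by simp
  qed simp
  finally show ?thesis using Pd by blast
qed

section \<open>Numerical constants and combination of the two regimes\<close>

lemma prob_KL_ge_antimono:
  assumes "measure_pmf.prob M {x. K x \<ge> ereal b} \<ge> \<delta>" "a \<le> b"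
  shows "measure_pmf.prob M {x. K x \<ge> ereal a} \<ge> \<delta>"
proof -
  have "measure_pmf.prob M {x. K x \<ge> ereal b} \<le> measure_pmf.prob M {x. K x \<ge> ereal a}"
    using assms(2) by (intro measure_pmf.finite_measure_mono) (auto intro: order_trans[rotated])
  with assms(1) show ?thesis by simp
qed

text \<open>The argument of the logarithm is \<open>L / (2 * \<kappa>) * ((d - 1) / d)\<close>.
  Since \<open>4 * \<kappa> < sqrt L\<close>, it is at least \<open>3/2 * sqrt L\<close>, so half of
  \<open>ln L\<close> survives; a quarter of \<open>ln L\<close> and \<open>ln (3/2)\<close>
  together absorb the \<open>- 1\<close>.\<close>

lemma rare_observation_rate:
  fixes L \<kappa> :: real and n d :: nat
  assumes "\<kappa> \<ge> 1" "L > 16 * \<kappa>\<^sup>2" "n > 0" "d \<ge> 4000"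
  shows "L * ln L / (8 * real n) \<le> L / (2 * real n) * (ln (L / (2 * real n) / (\<kappa> * d / n / real (d - 1))) - 1)"
proof -
  have "\<kappa>\<^sup>2 \<ge> 1" using assms(1) by simp
  then have L: "L > 16" using assms(2) by linarith
  have "sqrt (16 * \<kappa>\<^sup>2) < sqrt L" using assms(2) by (intro real_sqrt_less_mono)
  then have k: "4 * \<kappa> < sqrt L" using assms(1) by (simp add: real_sqrt_mult)
  have "ln L > ln 16" using L by simp
  moreover have "ln (16 :: real) = ln (2 ^ 4)" by simp
  then have "ln (16 :: real) = 4 * ln 2" by (subst (asm) ln_realpow) auto
  ultimately have ln2: "ln L > 4 * ln 2" by simp
  have "sqrt L * \<kappa> * 4 \<le> L"
    using mult_left_mono[OF less_imp_le[OF k], of "sqrt L"] L by (simp add: algebra_simps)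
  moreover have "real (d - 1) / d \<ge> 3/4" using assms(4) by (simp add: of_nat_diff pos_le_divide_eq)
  ultimately have "3 / 2 * sqrt L \<le> L / (2 * \<kappa>) * (real (d - 1) / d)"
  proof -
    assume a: "sqrt L * \<kappa> * 4 \<le> L" and b: "real (d - 1) / d \<ge> 3/4"
    have "2 * sqrt L \<le> L / (2 * \<kappa>)" using a assms(1) by (simp add: field_simps)
    then have "2 * sqrt L * (3/4) \<le> L / (2 * \<kappa>) * (real (d - 1) / d)"
      using L assms(1) by (intro mult_mono b) auto
    then show ?thesis by simp
  qed
  also have "\<dots> = L / (2 * real n) / (\<kappa> * d / n / real (d - 1))"
    using assms by (simp add: field_simps)
  finally have "ln (3 / 2 * sqrt L) \<le> ln (L / (2 * real n) / (\<kappa> * d / n / real (d - 1)))"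
    using L by (intro ln_mono) auto
  moreover have "ln (3 / 2 * sqrt L) = ln (3/2) + ln L / 2"
    using L by (subst ln_mult) (auto simp: ln_sqrt)
  moreover have "ln (3/2 :: real) \<ge> 1/3"
    using ln_le_minus_one[of "2/3 :: real"] by (simp add: ln_div)
  \<comment> \<open>Here \<open>ln L / 4 > ln 2 \<ge> 2/3\<close> and
    \<open>ln (3/2) \<ge> 1/3\<close> add up to at least 1.\<close>
  ultimately have "ln L / 4 \<le> ln (L / (2 * real n) / (\<kappa> * d / n / real (d - 1))) - 1"
    using ln2 ln2_ge_two_thirds by linarith
  then have "L / (2 * real n) * (ln L / 4) \<le> L / (2 * real n) * (ln (L / (2 * real n) / (\<kappa> * d / n / real (d - 1))) - 1)"
    using L by (intro mult_left_mono) auto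
  then show ?thesis by simp
qed

theorem theorem2:
  fixes n d :: nat and \<kappa> \<delta> :: real and \<Phi> :: "(nat \<Rightarrow> nat) \<Rightarrow> nat pmf"
  assumes "d \<ge> 4000" and "n \<ge> d" and "\<kappa> \<ge> 1"
    and "\<Phi> \<in> ({1..n} \<rightarrow>\<^sub>E {1..d}) \<rightarrow> prob_vectors d"
    and "\<And>P. P \<in> prob_vectors d \<Longrightarrow>
      measure_pmf.prob (sample_pmf n P)
        {x. KL d P (\<Phi> x) \<le> ereal (\<kappa> * real d / real n)} > 0"
    and "\<delta> \<in> {exp (- real n)<..<exp (- 16 * \<kappa>\<^sup>2)}"
  shows "\<exists>P \<in> prob_vectors d.
      measure_pmf.prob (sample_pmf n P)
        {x. KL d P (\<Phi> x) \<ge>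
          ereal ((real d + ln (1 / \<delta>) * ln (ln (1 / \<delta>))) / (5000 * real n))} \<ge> \<delta>"
proof -
  define L where "L = ln (1 / \<delta>)"
  have d0: "\<delta> > 0" using assms(6) by (auto intro: less_trans[OF exp_gt_zero])
  have eL: "\<delta> = exp (- L)" using d0 by (simp add: L_def ln_div)
  have L: "L < n" "L > 16 * \<kappa>\<^sup>2" using assms(6) by (auto simp: eL)
  have k2: "\<kappa>\<^sup>2 \<ge> 1" using assms(3) by simp
  have L16: "L > 16" using L k2 by linarith
  have n0: "n > 0" using assms by simp
  \<comment> \<open>Used with \<open>c\<close> the larger of \<open>d\<close> and
    \<open>L * ln L\<close>, so each regime has to supply only its dominant term.\<close>
  have rate: "(real d + L * ln L) / (5000 * real n) \<le> 2 * c / (5000 * real n)"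
    if "real d \<le> c" "L * ln L \<le> c" for c
    using that by (intro divide_right_mono) auto
  show ?thesis
  proof (cases "real d \<le> L * ln L")
    case True
    have "return_pmf 1 \<in> prob_vectors d" using assms(1) by (simp add: prob_vectors_def)
    then have "measure_pmf.prob (sample_pmf n (return_pmf 1))
        {x. KL d (return_pmf 1) (\<Phi> x) \<le> ereal (\<kappa> * real d / real n)} > 0" by (rule assms(5))
    then obtain P where P: "P \<in> prob_vectors d" "measure_pmf.prob (sample_pmf n P)
     {x. KL d P (\<Phi> x) \<ge> ereal (L / (2 * real n) * (ln (L / (2 * real n) / (\<kappa> * d / n / real (d - 1))) - 1))} \<ge> \<delta>"
      using rare_observation_lower_bound[OF _ _ L(1) assms(4), of "\<kappa> * d / n"] assms(1) L16
      unfolding eL by fastforce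
    have "2 * (L * ln L) / (5000 * real n) \<le> L * ln L / (8 * real n)"
      using L16 n0 by (simp add: field_simps)
    with rare_observation_rate[OF assms(3) L(2) n0 assms(1)] rate[OF True order_refl]
    show ?thesis using P unfolding L_def[symmetric] by (intro bexI[of _ P] prob_KL_ge_antimono[OF P(2)]) auto
  next
    case False
    obtain P where P: "P \<in> prob_vectors d" "measure_pmf.prob (sample_pmf n P)
     {x. KL d P (\<Phi> x) \<ge> ereal (real d / (600 * real n))} \<ge> 1 / 16"
      using minimax_lower_bound[OF assms(1,2,4)] by auto
    \<comment> \<open>The minimax bound holds with probability \<open>1/16\<close>, so
      \<open>\<delta> \<le> 1/16\<close> is needed; \<open>L > 16\<close> is more than
      enough.\<close>
    have "1 + L \<le> exp L" by (rule exp_ge_add_one_self)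
    then have "exp L \<ge> 16" using L16 by linarith
    then have "\<delta> \<le> 1 / 16" unfolding eL exp_minus by (simp add: field_simps)
    then have P2: "measure_pmf.prob (sample_pmf n P) {x. KL d P (\<Phi> x) \<ge> ereal (real d / (600 * real n))} \<ge> \<delta>"
      using P(2) by linarith
    have "2 * real d / (5000 * real n) \<le> real d / (600 * real n)" using n0 by (simp add: field_simps)
    then show ?thesis using P(1) rate[of d] False unfolding L_def[symmetric]
      by (intro bexI[of _ P] prob_KL_ge_antimono[OF P2]) auto
  qed
qed

end
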